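(* Let $H_1$ and $H_2$ be maximal sectorial relations in a Hilbert space $\mathfrak{H}$, with $A_{js}^{1/2}$, $B_j$ ($j=1,2$) and $B_\oplus=B_1\oplus B_2$ as in the context, and let $$\Psi=\left\{\{h,\{A_{1s}^{1/2}h,A_{2s}^{1/2}h\}\}:h\in\operatorname{dom}H_1\cap\operatorname{dom}H_2\right\}\subset\mathfrak{H}\times(\mathfrak{H}\times\mathfrak{H}).$$ The Friedrichs extension of $H_1+H_2$ is given by $$(H_1+H_2)_F=\Psi^*(I+iB_\oplus)\Psi^{**}$$ and the corresponding form is given by $$\mathfrak{t}_F[f,g]=\big((I+iB_\oplus)\Psi^{**}f,\Psi^{**}g\big),\quad f,g\in\operatorname{dom}\mathfrak{t}_F=\operatorname{dom}\Psi^{**}.$$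
   Context: Hilbert spaces are complex with inner product linear in the first entry; $\mathbf{B}(\mathfrak{H})$ is the set of bounded everywhere defined operators on $\mathfrak{H}$. A linear relation $T$ from $\mathfrak{H}$ to $\mathfrak{K}$ is a linear subspace of $\mathfrak{H}\times\mathfrak{K}$; operators are identified with their graphs. $\operatorname{dom}T$ is the set of first entries, $\ker T=\{f:\{f,0\}\in T\}$, $\operatorname{mul}T=\{k:\{0,k\}\in T\}$. The adjoint is $T^*=\{\{k,h\}\in\mathfrak{K}\times\mathfrak{H}:(k,f')=(h,f)\ \forall\{f,f'\}\in T\}$; $T^{**}$ is the closure of $T$. Products: $AB=\{\{f,h\}:\{f,g\}\in B,\ \{g,h\}\in A\text{ for some }g\}$; sums: $A+B=\{\{f,g+h\}:\{f,g\}\in A,\ \{f,h\}\in B\}$. A relation $S$ in $\mathfrak{H}$ is sectorial (vertex at the origin, semi-angle $\alpha\in[0,\pi/2)$) if $|\operatorname{Im}(h',h)|\le(\tan\alpha)\operatorname{Re}(h',h)$ for all $\{h,h'\}\in S$; it is maximal sectorial if it has no proper sectorial extension in $\mathfrak{H}$. For sectorial $S$ the form $\mathfrak{t}_S[\varphi,\psi]=(\varphi',\psi)$, $\{\varphi,\varphi'\},\{\psi,\psi'\}\in S$, $\operatorname{dom}\mathfrak{t}_S=\operatorname{dom}S$, is well defined, sectorial and closable. Closed (not necessarily densely defined) sectorial forms $\mathfrak{t}$ and maximal sectorial relations are in one-to-one correspondence via $H_{\mathfrak{t}}=\{\{\varphi,\varphi'\}:\varphi\in\operatorname{dom}\mathfrak{t},\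 \mathfrak{t}[\varphi,\psi]=(\varphi',\psi)\ \forall\psi\in\operatorname{dom}\mathfrak{t}\}$. The Friedrichs extension $S_F$ is the maximal sectorial relation corresponding to the closure of $\mathfrak{t}_S$. Pair data. For $j=1,2$ let $\mathfrak{t}_{H_j}$ be the closed sectorial form corresponding to $H_j$, and let $A_j$ be the nonnegative selfadjoint relation corresponding to the closed nonnegative form $\operatorname{Re}\mathfrak{t}_{H_j}$, where $(\operatorname{Re}\mathfrak{t})[h,k]=\tfrac12(\mathfrak{t}[h,k]+\overline{\mathfrak{t}[k,h]})$. Write $A_j=A_{js}\oplus(\{0\}\times\operatorname{mul}A_j)$, where $A_{js}=\{\{f,g\}\in A_j:g\perp\operatorname{mul}A_j\}$ is a nonnegative selfadjoint operator in $\mathfrak{H}\ominus\operatorname{mul}A_j$; $A_{js}^{1/2}$ is its nonnegative square root and $A_j^{1/2}=A_{js}^{1/2}\oplus(\{0\}\times\operatorname{mul}A_j)$. $B_j\in\mathbf{B}(\mathfrak{H})$ is the unique selfadjoint operator, zero on $\ker A_j\oplus\operatorname{mul}A_j$, such that $\mathfrak{t}_{H_j}[h,k]=((I+iB_j)A_{js}^{1/2}h,A_{js}^{1/2}k)$ for $h,k\in\operatorname{dom}\mathfrak{t}_{H_j}=\operatorname{dom}A_j^{1/2}$; then $H_j=A_j^{1/2}(I+iB_j)A_j^{1/2}$. $B_\oplus=B_1\oplus B_2$ is the orthogonal sum acting in $\mathfrak{H}\times\mathfrak{H}$. The sum $H_1+H_2$ is a sectorial relation with domain $\operatorname{dom}H_1\cap\operatorname{dom}H_2$,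 and $\Psi$ is a closable operator, so $\Psi^{**}$ is an operator. *)

theory Defs
  imports "HOL-Analysis.Analysis"
begin

section \<open>Complex Hilbert spaces\<close>

text \<open>The inner product is linear in the first entry. The last axiom ties it to the norm and
  contains its positive definiteness.\<close>

class complex_inner = real_normed_vector +
  fixes scaleC :: "complex \<Rightarrow> 'a \<Rightarrow> 'a" (infixr "*\<^sub>C" 75)
    and cinner :: "'a \<Rightarrow> 'a \<Rightarrow> complex"
  assumes scaleC_add_right: "c *\<^sub>C (x + y) = c *\<^sub>C x + c *\<^sub>C y"
    and scaleC_add_left: "(c + d) *\<^sub>C x = c *\<^sub>C x + d *\<^sub>C x"
    and scaleC_scaleC: "c *\<^sub>C d *\<^sub>C x = (c * d) *\<^sub>C x"
    and scaleC_one: "1 *\<^sub>C x = x"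
    and scaleR_scaleC: "r *\<^sub>R x = complex_of_real r *\<^sub>C x"
    and cinner_commute: "cinner x y = cnj (cinner y x)"
    and cinner_add_left: "cinner (x + y) z = cinner x z + cinner y z"
    and cinner_scaleC_left: "cinner (c *\<^sub>C x) y = c * cinner x y"
    and cinner_self: "cinner x x = complex_of_real ((norm x)\<^sup>2)"

class chilbert_space = complex_inner + complete_space

global_interpretation complex_vector:
  vector_space "scaleC :: complex \<Rightarrow> 'a \<Rightarrow> 'a::complex_inner"
  by unfold_locales (simp_all add: scaleC_add_right scaleC_add_left scaleC_scaleC scaleC_one)

instantiation prod :: (complex_inner, complex_inner) complex_inner
begin

definition scaleC_prod :: "complex \<Rightarrow> 'a \<times> 'b \<Rightarrow> 'a \<times> 'b" where
  "scaleC_prod c p = (c *\<^sub>C fst p, c *\<^sub>C snd p)"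

definition cinner_prod :: "'a \<times> 'b \<Rightarrow> 'a \<times> 'b \<Rightarrow> complex" where
  "cinner_prod p q = cinner (fst p) (fst q) + cinner (snd p) (snd q)"

instance
proof
  fix c d :: complex and r :: real and x y z :: "'a \<times> 'b"
  show "c *\<^sub>C (x + y) = c *\<^sub>C x + c *\<^sub>C y"
    by (simp add: scaleC_prod_def scaleC_add_right)
  show "(c + d) *\<^sub>C x = c *\<^sub>C x + d *\<^sub>C x"
    by (simp add: scaleC_prod_def scaleC_add_left)
  show "c *\<^sub>C d *\<^sub>C x = (c * d) *\<^sub>C x"
    by (simp add: scaleC_prod_def scaleC_scaleC)
  show "1 *\<^sub>C x = x"
    by (simp add: scaleC_prod_def scaleC_one)
  show "r *\<^sub>R x = complex_of_real r *\<^sub>C x"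
    by (simp add: scaleC_prod_def scaleR_prod_def scaleR_scaleC)
  show "cinner x y = cnj (cinner y x)"
    by (simp add: cinner_prod_def cinner_commute[of "fst x"] cinner_commute[of "snd x"])
  show "cinner (x + y) z = cinner x z + cinner y z"
    by (simp add: cinner_prod_def cinner_add_left)
  show "cinner (c *\<^sub>C x) y = c * cinner x y"
    by (simp add: cinner_prod_def scaleC_prod_def cinner_scaleC_left distrib_left)
  show "cinner x x = complex_of_real ((norm x)\<^sup>2)"
    by (simp add: cinner_prod_def cinner_self norm_prod_def)
qed

end

instance prod :: (chilbert_space, chilbert_space) chilbert_space ..

definition ocompl :: "'a::complex_inner set \<Rightarrow> 'a set" where
  "ocompl M = {x. \<forall>y\<in>M. cinner x y = 0}"

definition bounded_clinear :: "('a::complex_inner \<Rightarrow> 'b::complex_inner) \<Rightarrow> bool" where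
  "bounded_clinear B \<longleftrightarrow> bounded_linear B \<and> (\<forall>c x. B (c *\<^sub>C x) = c *\<^sub>C B x)"


section \<open>Linear relations\<close>

text \<open>A linear relation is a set of pairs that is a complex linear subspace. Its domain is
  \<^const>\<open>Domain\<close>; the product $AB$ (first $B$, then $A$) is the relational composition
  \<open>B O A\<close> of the library.\<close>

abbreviation lin_rel :: "('a::complex_inner \<times> 'b::complex_inner) set \<Rightarrow> bool" where
  "lin_rel T \<equiv> complex_vector.subspace T"

definition ker_rel :: "('a::complex_inner \<times> 'b::complex_inner) set \<Rightarrow> 'a set" where
  "ker_rel T = {f. (f, 0) \<in> T}"

definition mul_rel :: "('a::complex_inner \<times> 'b::complex_inner) set \<Rightarrow> 'b set" where
  "mul_rel T = {k. (0, k) \<in> T}"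

definition adjoint_rel ::
    "('a::complex_inner \<times> 'b::complex_inner) set \<Rightarrow> ('b \<times> 'a) set" where
  "adjoint_rel T = {(k, h). \<forall>(f, f')\<in>T. cinner k f' = cinner h f}"

definition sum_rel ::
    "('a \<times> 'b) set \<Rightarrow> ('a \<times> 'b) set \<Rightarrow> ('a \<times> 'b::complex_inner) set" where
  "sum_rel A B = {(f, g + h) | f g h. (f, g) \<in> A \<and> (f, h) \<in> B}"

definition graph_rel :: "('a \<Rightarrow> 'b) \<Rightarrow> ('a \<times> 'b) set" where
  "graph_rel B = {(x, B x) | x. True}"

text \<open>The value \<open>T f\<close> when \<open>T\<close> is (the graph of) an operator and \<open>f\<close> lies in its domain.\<close>

definition op_apply :: "('a \<times> 'b) set \<Rightarrow> 'a \<Rightarrow> 'b" where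
  "op_apply T f = (THE g. (f, g) \<in> T)"

definition op_part :: "('a::complex_inner \<times> 'a) set \<Rightarrow> ('a \<times> 'a) set" where
  "op_part A = {(f, g) \<in> A. g \<in> ocompl (mul_rel A)}"

definition nonneg_rel :: "('a::complex_inner \<times> 'a) set \<Rightarrow> bool" where
  "nonneg_rel T \<longleftrightarrow>
     (\<forall>(h, h')\<in>T. Im (cinner h' h) = 0 \<and> 0 \<le> Re (cinner h' h))"

definition sectorial_rel :: "('a::complex_inner \<times> 'a) set \<Rightarrow> bool" where
  "sectorial_rel S \<longleftrightarrow> lin_rel S \<and>
     (\<exists>\<alpha>. 0 \<le> \<alpha> \<and> \<alpha> < pi / 2 \<and>
        (\<forall>(h, h')\<in>S. \<bar>Im (cinner h' h)\<bar> \<le> tan \<alpha> * Re (cinner h' h)))"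

definition maximal_sectorial :: "('a::complex_inner \<times> 'a) set \<Rightarrow> bool" where
  "maximal_sectorial S \<longleftrightarrow> sectorial_rel S \<and>
     (\<forall>S'. sectorial_rel S' \<and> S \<subseteq> S' \<longrightarrow> S' = S)"

text \<open>Selfadjointness in the closed subspace \<open>K\<close>, regarded as a Hilbert space of its own.\<close>

definition selfadjoint_in :: "'a::complex_inner set \<Rightarrow> ('a \<times> 'a) set \<Rightarrow> bool" where
  "selfadjoint_in K T \<longleftrightarrow> adjoint_rel T \<inter> K \<times> K = T"

definition nonneg_sqrt_in ::
    "'a::complex_inner set \<Rightarrow> ('a \<times> 'a) set \<Rightarrow> ('a \<times> 'a) set \<Rightarrow> bool" where
  "nonneg_sqrt_in K T R \<longleftrightarrow>
     single_valued R \<and> selfadjoint_in K R \<and> nonneg_rel R \<and> R O R = T"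


section \<open>Sectorial forms\<close>

text \<open>A form consists of its domain and its values; values outside the domain are irrelevant.\<close>

datatype 'a form = Form (fdom: "'a set") (fval: "'a \<Rightarrow> 'a \<Rightarrow> complex")

definition sesquilinear_form :: "'a::complex_inner form \<Rightarrow> bool" where
  "sesquilinear_form t \<longleftrightarrow> complex_vector.subspace (fdom t) \<and>
     (\<forall>x\<in>fdom t. \<forall>y\<in>fdom t. \<forall>z\<in>fdom t. \<forall>c.
        fval t (x + y) z = fval t x z + fval t y z \<and>
        fval t (c *\<^sub>C x) z = c * fval t x z \<and>
        fval t z (x + y) = fval t z x + fval t z y \<and>
        fval t z (c *\<^sub>C x) = cnj c * fval t z x)"

definition sectorial_form :: "'a::complex_inner form \<Rightarrow> bool" where
  "sectorial_form t \<longleftrightarrow> sesquilinear_form t \<and>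
     (\<exists>\<alpha>. 0 \<le> \<alpha> \<and> \<alpha> < pi / 2 \<and>
        (\<forall>\<phi>\<in>fdom t. \<bar>Im (fval t \<phi> \<phi>)\<bar> \<le> tan \<alpha> * Re (fval t \<phi> \<phi>)))"

text \<open>Kato's \<open>t\<close>-convergence of a sequence in the form domain to a vector of the space, and
  closedness and closure of a form in terms of it.\<close>

definition form_conv :: "'a::complex_inner form \<Rightarrow> (nat \<Rightarrow> 'a) \<Rightarrow> 'a \<Rightarrow> bool" where
  "form_conv t x u \<longleftrightarrow> (\<forall>n. x n \<in> fdom t) \<and> x \<longlonglongrightarrow> u \<and>
     (\<forall>e>0. \<exists>N. \<forall>m\<ge>N. \<forall>n\<ge>N. cmod (fval t (x n - x m) (x n - x m)) < e)"

definition closed_form :: "'a::complex_inner form \<Rightarrow> bool" where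
  "closed_form t \<longleftrightarrow> (\<forall>x u. form_conv t x u \<longrightarrow>
     u \<in> fdom t \<and> (\<lambda>n. fval t (x n - u) (x n - u)) \<longlonglongrightarrow> 0)"

definition form_closure :: "'a::complex_inner form \<Rightarrow> 'a form" where
  "form_closure t = Form {u. \<exists>x. form_conv t x u}
     (\<lambda>u v. THE c. \<forall>x y. form_conv t x u \<longrightarrow> form_conv t y v \<longrightarrow>
        (\<lambda>n. fval t (x n) (y n)) \<longlonglongrightarrow> c)"

definition re_form :: "'a form \<Rightarrow> 'a form" where
  "re_form t = Form (fdom t) (\<lambda>h k. (fval t h k + cnj (fval t k h)) / 2)"

text \<open>The form \<open>t\<^sub>S\<close> of a sectorial relation \<open>S\<close> and, conversely, the relation \<open>H\<^sub>t\<close> of a form.\<close>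

definition form_of_rel :: "('a::complex_inner \<times> 'a) set \<Rightarrow> 'a form" where
  "form_of_rel S = Form (Domain S)
     (\<lambda>\<phi> \<psi>. THE c. \<exists>\<phi>'. (\<phi>, \<phi>') \<in> S \<and> c = cinner \<phi>' \<psi>)"

definition rel_of_form :: "'a::complex_inner form \<Rightarrow> ('a \<times> 'a) set" where
  "rel_of_form t =
     {(\<phi>, \<phi>'). \<phi> \<in> fdom t \<and> (\<forall>\<psi>\<in>fdom t. fval t \<phi> \<psi> = cinner \<phi>' \<psi>)}"

definition closed_sectorial_form_of ::
    "('a::complex_inner \<times> 'a) set \<Rightarrow> 'a form \<Rightarrow> bool" where
  "closed_sectorial_form_of H t \<longleftrightarrow>
     sectorial_form t \<and> closed_form t \<and> rel_of_form t = H"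

definition friedrichs_form :: "('a::complex_inner \<times> 'a) set \<Rightarrow> 'a form" where
  "friedrichs_form S = form_closure (form_of_rel S)"

definition friedrichs_ext :: "('a::complex_inner \<times> 'a) set \<Rightarrow> ('a \<times> 'a) set" where
  "friedrichs_ext S = rel_of_form (friedrichs_form S)"


section \<open>Representation of maximal sectorial relations\<close>

definition one_plus_i :: "('a::complex_inner \<Rightarrow> 'a) \<Rightarrow> 'a \<Rightarrow> 'a" where
  "one_plus_i B x = x + \<i> *\<^sub>C B x"

text \<open>\<open>B\<close> is the bounded selfadjoint operator that represents the form \<open>t\<close> with respect to the
  square root \<open>R\<close> of the operator part of \<open>A\<close>, where \<open>A\<close> is the relation of the real part of
  \<open>t\<close>. The domain of \<open>R\<close> then equals \<open>fdom t\<close>, so that \<open>op_apply R\<close> is meaningful there.\<close>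

definition represents_form ::
    "'a::complex_inner form \<Rightarrow> ('a \<times> 'a) set \<Rightarrow> ('a \<times> 'a) set \<Rightarrow> ('a \<Rightarrow> 'a) \<Rightarrow> bool" where
  "represents_form t A R B \<longleftrightarrow>
     bounded_clinear B \<and> adjoint_rel (graph_rel B) = graph_rel B \<and>
     (\<forall>x\<in>ker_rel A. \<forall>y\<in>mul_rel A. B (x + y) = 0) \<and>
     (\<forall>h\<in>fdom t. \<forall>k\<in>fdom t.
        fval t h k = cinner (one_plus_i B (op_apply R h)) (op_apply R k))"

definition pair_op :: "('a \<times> 'a) set \<Rightarrow> ('a \<times> 'a) set \<Rightarrow> ('a \<times> 'a) set \<Rightarrow> ('a \<times> 'a) set \<Rightarrow>
    ('a \<times> ('a \<times> 'a)) set" where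
  "pair_op H\<^sub>1 H\<^sub>2 R\<^sub>1 R\<^sub>2 =
     {(h, (op_apply R\<^sub>1 h, op_apply R\<^sub>2 h)) | h. h \<in> Domain H\<^sub>1 \<inter> Domain H\<^sub>2}"

end

theory Submission
  imports Defs
begin

text \<open>For \<open>h\<close> in \<open>dom H\<^sub>1 \<inter> dom H\<^sub>2\<close> the form of \<open>H\<^sub>1 + H\<^sub>2\<close> is \<open>((I + i B) \<Psi> h, \<Psi> k)\<close>. Since
  \<open>B\<close> is bounded and selfadjoint, \<open>Re ((I + i B) v, v) = \<parallel>v\<parallel>\<^sup>2\<close>, so convergence with respect to this
  form is convergence in the graph norm of \<open>\<Psi>\<close>. Closedness of the two given forms therefore makes
  the operators \<open>h \<mapsto> A\<^sub>j\<^sub>s\<^sup>1\<^sup>/\<^sup>2 h\<close> closed, hence \<open>\<Psi>\<close> closable, and the closure of the form is obtained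
  by replacing \<open>\<Psi>\<close> with its closure \<open>\<Psi>\<^sup>*\<^sup>*\<close>.\<close>

section \<open>Geometry of complex Hilbert spaces\<close>

lemma cinner_add_right: "cinner x (y + z) = cinner x y + cinner x z"
  by (metis cinner_add_left cinner_commute complex_cnj_add)

lemma cinner_scaleC_right: "cinner x (c *\<^sub>C y) = cnj c * cinner x y"
  by (metis cinner_commute cinner_scaleC_left complex_cnj_mult)

lemma cinner_zero [simp]: "cinner 0 y = 0" "cinner y 0 = 0"
  using cinner_add_left[of 0 0 y] cinner_add_right[of y 0 0] by simp_all

lemma cinner_minus [simp]: "cinner (- x) y = - cinner x y" "cinner x (- y) = - cinner x y"
  using cinner_add_left[of x "- x" y] cinner_add_right[of x y "- y"]
  by (simp_all add: add_eq_0_iff)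

lemma cinner_diff_left: "cinner (x - y) z = cinner x z - cinner y z"
  using cinner_add_left[of x "- y" z] by simp

lemma cinner_diff_right: "cinner x (y - z) = cinner x y - cinner x z"
  using cinner_add_right[of x y "- z"] by simp

lemma Re_cinner_self: "Re (cinner x x) = (norm x)\<^sup>2"
  by (simp add: cinner_self)

lemma norm_diff_sq:
  "(norm (x - y))\<^sup>2 = (norm x)\<^sup>2 + (norm y)\<^sup>2 - 2 * Re (cinner x y)"
proof -
  have "Re (cinner y x) = Re (cinner x y)"
    using cinner_commute[of y x] by simp
  then show ?thesis
    unfolding Re_cinner_self[symmetric] by (simp add: cinner_diff_left cinner_diff_right)
qed

text \<open>The class supplies only real homogeneity of the norm. The complex case comes from
  \<open>cinner_self\<close>, which turns it into an identity between squared norms.\<close>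

lemma norm_scaleC: "norm (c *\<^sub>C x) = cmod c * norm x"
proof -
  have "complex_of_real ((norm (c *\<^sub>C x))\<^sup>2) = complex_of_real ((cmod c * norm x)\<^sup>2)"
    unfolding cinner_self[symmetric] cinner_scaleC_left cinner_scaleC_right
    by (simp add: cinner_self power_mult_distrib complex_norm_square[unfolded of_real_power] mult_ac)
  then have "(norm (c *\<^sub>C x))\<^sup>2 = (cmod c * norm x)\<^sup>2"
    using of_real_eq_iff by blast
  then show ?thesis
    by (simp add: power2_eq_iff_nonneg)
qed

text \<open>Pythagoras: the subtracted vector is the orthogonal projection of \<open>x\<close> onto
  the line spanned by \<open>y\<close>. Nonnegativity of the left side yields Cauchy-Schwarz, and
  the decrease against \<open>(norm x)\<^sup>2\<close> yields orthogonality at a nearest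
  point.\<close>

lemma norm_diff_projection_sq:
  fixes x y :: "'a::complex_inner"
  assumes "y \<noteq> 0"
  shows "(norm (x - (cinner x y / (norm y)\<^sup>2) *\<^sub>C y))\<^sup>2 =
    (norm x)\<^sup>2 - (cmod (cinner x y))\<^sup>2 / (norm y)\<^sup>2"
proof -
  define c where "c = cinner x y / complex_of_real ((norm y)\<^sup>2)"
  define w where "w = cmod (cinner x y)"
  have n: "norm y > 0"
    using assms by simp
  have "cmod c = w / (norm y)\<^sup>2"
    by (simp add: c_def w_def norm_divide norm_power)
  moreover have "cnj c * cinner x y = complex_of_real (w\<^sup>2 / (norm y)\<^sup>2)"
    by (simp add: c_def w_def complex_norm_square[unfolded of_real_power] mult_ac)
  ultimately have "(norm (x - c *\<^sub>C y))\<^sup>2 =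
      (norm x)\<^sup>2 + (w / (norm y)\<^sup>2 * norm y)\<^sup>2 - 2 * (w\<^sup>2 / (norm y)\<^sup>2)"
    unfolding norm_diff_sq norm_scaleC cinner_scaleC_right by (simp only: Re_complex_of_real)
  also have "\<dots> = (norm x)\<^sup>2 - w\<^sup>2 / (norm y)\<^sup>2"
    using n by (simp add: field_simps power2_eq_square)
  finally show ?thesis
    by (simp add: c_def w_def)
qed

lemma cmod_cinner_le: "cmod (cinner x y) \<le> norm x * norm y"
proof (cases "y = 0")
  case False
  then have "0 \<le> (norm x)\<^sup>2 - (cmod (cinner x y))\<^sup>2 / (norm y)\<^sup>2"
    by (metis norm_diff_projection_sq zero_le_power2)
  then have "(cmod (cinner x y))\<^sup>2 \<le> (norm x * norm y)\<^sup>2"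
    using False by (simp add: field_simps power_mult_distrib)
  then show ?thesis
    by (rule power2_le_imp_le) simp
qed simp

text \<open>Conjugate linearity in the second entry is invisible to real scalars, so the inner
  product is bilinear over the reals and inherits joint continuity from the library.\<close>

lemma bounded_bilinear_cinner: "bounded_bilinear cinner"
proof
  fix r :: real and a b :: 'a
  show "cinner (r *\<^sub>R a) b = r *\<^sub>R cinner a b"
    by (simp add: scaleR_scaleC cinner_scaleC_left scaleR_conv_of_real)
  show "cinner a (r *\<^sub>R b) = r *\<^sub>R cinner a b"
    by (simp add: scaleR_scaleC cinner_scaleC_right scaleR_conv_of_real)
  show "\<exists>K. \<forall>a b::'a. cmod (cinner a b) \<le> norm a * norm b * K"
    by (rule exI[of _ 1]) (simp add: cmod_cinner_le)
qed (simp_all add: cinner_add_left cinner_add_right)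

lemmas tendsto_cinner = bounded_bilinear.tendsto[OF bounded_bilinear_cinner]

lemma bounded_linear_scaleC: "bounded_linear (\<lambda>x. c *\<^sub>C x)"
proof
  fix r :: real and x y :: 'a
  show "c *\<^sub>C (x + y) = c *\<^sub>C x + c *\<^sub>C y"
    by (rule scaleC_add_right)
  show "c *\<^sub>C (r *\<^sub>R x) = r *\<^sub>R (c *\<^sub>C x)"
    by (simp add: scaleR_scaleC scaleC_scaleC mult.commute)
  show "\<exists>K. \<forall>x::'a. norm (c *\<^sub>C x) \<le> norm x * K"
    by (rule exI[of _ "cmod c"]) (simp add: norm_scaleC)
qed

lemmas tendsto_scaleC = bounded_linear.tendsto[OF bounded_linear_scaleC]

section \<open>Best approximation and double orthogonal complements\<close>

lemma parallelogram:
  fixes x y :: "'a::complex_inner"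
  shows "(norm (x + y))\<^sup>2 + (norm (x - y))\<^sup>2 = 2 * (norm x)\<^sup>2 + 2 * (norm y)\<^sup>2"
  using norm_diff_sq[of x y] norm_diff_sq[of x "- y"] by simp

lemma subspace_closure:
  assumes "complex_vector.subspace M"
  shows "complex_vector.subspace (closure M)"
proof (rule complex_vector.subspaceI)
  show "0 \<in> closure M"
    using assms closure_subset complex_vector.subspace_0 by blast
next
  fix x y assume "x \<in> closure M" "y \<in> closure M"
  then obtain f g where "\<forall>n. f n \<in> M" "f \<longlonglongrightarrow> x" "\<forall>n. g n \<in> M" "g \<longlonglongrightarrow> y"
    by (auto simp: closure_sequential)
  then have "\<forall>n. f n + g n \<in> M" "(\<lambda>n. f n + g n) \<longlonglongrightarrow> x + y"
    by (auto intro: tendsto_add complex_vector.subspace_add[OF assms])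
  then show "x + y \<in> closure M"
    unfolding closure_sequential by (intro exI[of _ "\<lambda>n. f n + g n"]) simp
next
  fix c x assume "x \<in> closure M"
  then obtain f where "\<forall>n. f n \<in> M" "f \<longlonglongrightarrow> x"
    by (auto simp: closure_sequential)
  then have "\<forall>n. c *\<^sub>C f n \<in> M" "(\<lambda>n. c *\<^sub>C f n) \<longlonglongrightarrow> c *\<^sub>C x"
    by (auto intro: tendsto_scaleC complex_vector.subspace_scale[OF assms])
  then show "c *\<^sub>C x \<in> closure M"
    unfolding closure_sequential by (intro exI[of _ "\<lambda>n. c *\<^sub>C f n"]) simp
qed

text \<open>A minimizing sequence for the distance is Cauchy by the parallelogram law; its limit
  exists by completeness and stays in \<open>M\<close> because \<open>M\<close> is closed.\<close>

lemma ex_nearest_point: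
  fixes M :: "'a::chilbert_space set"
  assumes M: "complex_vector.subspace M" and "closed M"
  obtains p where "p \<in> M" "\<And>m. m \<in> M \<Longrightarrow> norm (x - p) \<le> norm (x - m)"
proof -
  define d where "d = (INF m\<in>M. norm (x - m))"
  have "0 \<in> M"
    by (rule complex_vector.subspace_0[OF M])
  have bdd: "bdd_below ((\<lambda>m. norm (x - m)) ` M)"
    by (rule bdd_belowI2[of _ 0]) simp
  have d_le: "d \<le> norm (x - m)" if "m \<in> M" for m
    unfolding d_def using that bdd by (rule cINF_lower[rotated])
  have "0 \<le> d"
    unfolding d_def using \<open>0 \<in> M\<close> by (intro cINF_greatest) auto
  have "\<exists>m\<in>M. norm (x - m) < d + inverse (real (Suc n))" for n
  proof -
    have "d < d + inverse (real (Suc n))"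
      by simp
    then show ?thesis
      using cINF_less_iff[OF _ bdd, of "d + inverse (real (Suc n))"] \<open>0 \<in> M\<close>
      by (auto simp: d_def)
  qed
  then obtain f where f: "\<And>n. f n \<in> M" "\<And>n. norm (x - f n) < d + inverse (real (Suc n))"
    by metis
  have "(\<lambda>n. d + inverse (real (Suc n))) \<longlonglongrightarrow> d + 0"
    by (intro tendsto_intros LIMSEQ_inverse_real_of_nat)
  then have "(\<lambda>n. d + inverse (real (Suc n))) \<longlonglongrightarrow> d"
    by simp
  then have lim: "(\<lambda>n. norm (x - f n)) \<longlonglongrightarrow> d"
    by (rule tendsto_sandwich[OF _ _ tendsto_const, rotated 2])
      (use d_le f in \<open>auto intro!: always_eventually less_imp_le simp del: of_nat_Suc\<close>)
  \<comment> \<open>The midpoint of \<open>f m\<close> and \<open>f n\<close> lies in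
    \<open>M\<close>, so the sum of \<open>x - f m\<close> and \<open>x - f n\<close> has norm at
    least \<open>2 * d\<close>. The parallelogram law then bounds their difference.\<close>
  have gap: "(norm (f m - f n))\<^sup>2 \<le> 2 * ((norm (x - f m))\<^sup>2 - d\<^sup>2) + 2 * ((norm (x - f n))\<^sup>2 - d\<^sup>2)" for m n
  proof -
    have "(1/2) *\<^sub>R (f m + f n) \<in> M"
      unfolding scaleR_scaleC
      by (intro complex_vector.subspace_scale[OF M] complex_vector.subspace_add[OF M] f)
    then have "d \<le> norm (x - (1/2) *\<^sub>R (f m + f n))"
      by (rule d_le)
    moreover have "(x - f m) + (x - f n) = 2 *\<^sub>R (x - (1/2) *\<^sub>R (f m + f n))"
      by (simp add: scaleR_diff_right scaleR_2)
    ultimately have "2 * d \<le> norm ((x - f m) + (x - f n))"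
      by simp
    then have "(2 * d)\<^sup>2 \<le> (norm ((x - f m) + (x - f n)))\<^sup>2"
      using \<open>0 \<le> d\<close> by (intro power_mono) auto
    then show ?thesis
      using parallelogram[of "x - f m" "x - f n"]
      by (simp add: norm_minus_commute power_mult_distrib)
  qed
  have "Cauchy f"
  proof (rule CauchyI)
    fix e :: real assume "0 < e"
    have "(\<lambda>n. (norm (x - f n))\<^sup>2 - d\<^sup>2) \<longlonglongrightarrow> d\<^sup>2 - d\<^sup>2"
      by (intro tendsto_intros lim)
    \<comment> \<open>With \<open>e\<^sup>2 / 4\<close> the two doubled excesses in
      \<open>gap\<close> add up to less than \<open>e\<^sup>2\<close>.\<close>
    then have "\<forall>\<^sub>F n in sequentially. (norm (x - f n))\<^sup>2 - d\<^sup>2 < e\<^sup>2 / 4"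
      using \<open>0 < e\<close> by (intro order_tendstoD(2)) auto
    then obtain N where N: "\<And>n. n \<ge> N \<Longrightarrow> (norm (x - f n))\<^sup>2 - d\<^sup>2 < e\<^sup>2 / 4"
      by (auto simp: eventually_sequentially)
    have "norm (f m - f n) < e" if "m \<ge> N" "n \<ge> N" for m n
    proof (rule power2_less_imp_less)
      show "(norm (f m - f n))\<^sup>2 < e\<^sup>2"
        using gap[of m n] N[OF that(1)] N[OF that(2)] by argo
    qed (use \<open>0 < e\<close> in simp)
    then show "\<exists>N. \<forall>m\<ge>N. \<forall>n\<ge>N. norm (f m - f n) < e"
      by blast
  qed
  then obtain p where p: "f \<longlonglongrightarrow> p"
    by (auto simp: Cauchy_convergent_iff convergent_def)
  have "p \<in> M"
    using \<open>closed M\<close> f(1) p by (auto simp: closed_sequential_limits)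
  moreover have "(\<lambda>n. norm (x - f n)) \<longlonglongrightarrow> norm (x - p)"
    by (intro tendsto_intros p)
  then have "norm (x - p) = d"
    using lim LIMSEQ_unique by blast
  ultimately show ?thesis
    using that d_le by metis
qed

text \<open>For the nontrivial inclusion let \<open>p\<close> be a point of \<open>M\<close> nearest
  to \<open>x\<close>. Then \<open>x - p\<close> is orthogonal to \<open>M\<close>, hence to
  \<open>p\<close>, and \<open>x\<close> is orthogonal to \<open>x - p\<close>; so
  \<open>x - p\<close> is orthogonal to itself.\<close>

lemma ocompl_ocompl_closed:
  fixes M :: "'a::chilbert_space set"
  assumes M: "complex_vector.subspace M" and "closed M"
  shows "ocompl (ocompl M) = M"
proof
  show "M \<subseteq> ocompl (ocompl M)"
    by (auto simp: ocompl_def) (subst cinner_commute, simp)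
  show "ocompl (ocompl M) \<subseteq> M"
  proof
    fix x assume x: "x \<in> ocompl (ocompl M)"
    obtain p where p: "p \<in> M" "\<And>m. m \<in> M \<Longrightarrow> norm (x - p) \<le> norm (x - m)"
      using ex_nearest_point[OF assms] by blast
    have orth: "cinner (x - p) y = 0" if "y \<in> M" for y
    proof (cases "y = 0")
      case False
      \<comment> \<open>The coefficient of the projection of \<open>x - p\<close> onto the line of
        \<open>y\<close>: were the inner product nonzero, moving \<open>p\<close> by this multiple
        of \<open>y\<close> would bring it strictly closer to \<open>x\<close>.\<close>
      let ?c = "cinner (x - p) y / (norm y)\<^sup>2"
      have "p + ?c *\<^sub>C y \<in> M"
        by (intro complex_vector.subspace_add[OF M] complex_vector.subspace_scale[OF M] p that)
      then have "norm (x - p) \<le> norm (x - p - ?c *\<^sub>C y)"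
        using p(2) by (fastforce simp: algebra_simps)
      then have "(norm (x - p))\<^sup>2 \<le> (norm (x - p - ?c *\<^sub>C y))\<^sup>2"
        by (intro power_mono) auto
      then have "(cmod (cinner (x - p) y))\<^sup>2 / (norm y)\<^sup>2 \<le> 0"
        unfolding norm_diff_projection_sq[OF False] by simp
      then show ?thesis
        using False by (simp add: divide_le_0_iff)
    qed simp
    then have "x - p \<in> ocompl M"
      by (simp add: ocompl_def)
    then have "cinner x (x - p) = 0"
      using x by (simp add: ocompl_def)
    moreover have "cinner p (x - p) = 0"
      using orth[OF p(1)] cinner_commute[of p "x - p"] by simp
    ultimately have "cinner (x - p) (x - p) = 0"
      by (simp add: cinner_diff_left)
    then have "x = p"
      by (simp add: cinner_self)
    then show "x \<in> M"
      using p(1) by simp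
  qed
qed

lemma ocompl_closure: "ocompl (closure M) = ocompl M"
proof
  show "ocompl (closure M) \<subseteq> ocompl M"
    using closure_subset by (auto simp: ocompl_def)
  show "ocompl M \<subseteq> ocompl (closure M)"
  proof
    fix x assume x: "x \<in> ocompl M"
    have "cinner x y = 0" if "y \<in> closure M" for y
    proof -
      from that obtain f where f: "\<forall>n. f n \<in> M" "f \<longlonglongrightarrow> y"
        by (auto simp: closure_sequential)
      have "(\<lambda>n. cinner x (f n)) \<longlonglongrightarrow> cinner x y"
        by (intro tendsto_cinner tendsto_const f)
      then show ?thesis
        using f(1) x by (simp add: ocompl_def LIMSEQ_const_iff)
    qed
    then show "x \<in> ocompl (closure M)"
      by (simp add: ocompl_def)
  qed
qed

lemma ocompl_ocompl:
  fixes M :: "'a::chilbert_space set"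
  assumes "complex_vector.subspace M"
  shows "ocompl (ocompl M) = closure M"
  using ocompl_ocompl_closed[OF subspace_closure[OF assms]] by (simp add: ocompl_closure)

section \<open>Linear relations\<close>

text \<open>The defining identity says that \<open>(- h, k)\<close> is orthogonal to
  \<open>(f, f')\<close> in the product space, so the adjoint is a rotated orthogonal complement of
  the graph.\<close>

lemma adjoint_rel_conv_ocompl: "adjoint_rel T = {(k, h). (- h, k) \<in> ocompl T}"
  by (auto simp: adjoint_rel_def ocompl_def cinner_prod_def)

text \<open>Two rotations amount to a change of sign, which a complement does not see. In the proof
  the sign is absorbed by replacing the bound \<open>h\<close> by \<open>- h\<close>.\<close>

lemma adjoint_adjoint_conv_ocompl: "adjoint_rel (adjoint_rel T) = ocompl (ocompl T)"
proof -
  have neg: "(\<forall>h. Q h) \<longleftrightarrow> (\<forall>h. Q (- h))" for Q :: "'a \<Rightarrow> bool"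
    by (metis minus_minus)
  have "(f, f') \<in> ocompl (ocompl T) \<longleftrightarrow> (f, f') \<in> adjoint_rel (adjoint_rel T)" for f f'
  proof -
    have "(f, f') \<in> ocompl (ocompl T) \<longleftrightarrow>
        (\<forall>h. \<forall>k. (h, k) \<in> ocompl T \<longrightarrow> cinner f h + cinner f' k = 0)"
      by (auto simp: ocompl_def[of "ocompl T"] cinner_prod_def)
    also have "\<dots> \<longleftrightarrow> (\<forall>h. \<forall>k. (- h, k) \<in> ocompl T \<longrightarrow> cinner f (- h) + cinner f' k = 0)"
      by (rule neg)
    also have "\<dots> \<longleftrightarrow> (f, f') \<in> adjoint_rel (adjoint_rel T)"
      unfolding adjoint_rel_def[of "adjoint_rel T"] by (auto simp: adjoint_rel_conv_ocompl)
    finally show ?thesis .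
  qed
  then show ?thesis
    by auto
qed

text \<open>This replaces the double adjoint of the pair operator by a closure, which can be handled
  with sequences.\<close>

lemma adjoint_adjoint_eq_closure:
  fixes T :: "('a::chilbert_space \<times> 'b::chilbert_space) set"
  assumes "lin_rel T"
  shows "adjoint_rel (adjoint_rel T) = closure T"
  unfolding adjoint_adjoint_conv_ocompl by (rule ocompl_ocompl[OF assms])

lemma adjoint_rel_closure: "adjoint_rel (closure T) = adjoint_rel T"
  by (simp add: adjoint_rel_conv_ocompl ocompl_closure)

lemma lin_rel_add: "lin_rel T \<Longrightarrow> (x, y) \<in> T \<Longrightarrow> (x', y') \<in> T \<Longrightarrow> (x + x', y + y') \<in> T"
  using complex_vector.subspace_add[of T "(x, y)" "(x', y')"] by simp

lemma lin_rel_diff: "lin_rel T \<Longrightarrow> (x, y) \<in> T \<Longrightarrow> (x', y') \<in> T \<Longrightarrow> (x - x', y - y') \<in> T"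
  using complex_vector.subspace_diff[of T "(x, y)" "(x', y')"] by simp

lemma lin_rel_scaleC: "lin_rel T \<Longrightarrow> (x, y) \<in> T \<Longrightarrow> (c *\<^sub>C x, c *\<^sub>C y) \<in> T"
  using complex_vector.subspace_scale[of T "(x, y)" c] by (simp add: scaleC_prod_def)

lemma op_apply_eq: "single_valued T \<Longrightarrow> (f, g) \<in> T \<Longrightarrow> op_apply T f = g"
  unfolding op_apply_def by (auto dest: single_valuedD)

section \<open>Forms factored through an operator\<close>

text \<open>Captures what is used of I + iB with \<open>B\<close> bounded and selfadjoint. The
  property passes to direct sums.\<close>

definition unit_real_part :: "('a::complex_inner \<Rightarrow> 'a) \<Rightarrow> bool" where
  "unit_real_part C \<longleftrightarrow> bounded_clinear C \<and> (\<forall>x. Re (cinner (C x) x) = (norm x)\<^sup>2)"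

text \<open>The shape t[f,g] = (C P f, P g), with \<open>P\<close> kept as a graph so that closure
  and adjoint apply to it directly. It covers the two given forms, the form of the sum and the
  closure of the latter.\<close>

definition factored_form ::
    "'a::complex_inner form \<Rightarrow> ('a \<times> 'b::complex_inner) set \<Rightarrow> ('b \<Rightarrow> 'b) \<Rightarrow> bool" where
  "factored_form t P C \<longleftrightarrow> single_valued P \<and> lin_rel P \<and> fdom t = Domain P \<and>
     (\<forall>f f' g g'. (f, f') \<in> P \<longrightarrow> (g, g') \<in> P \<longrightarrow> fval t f g = cinner (C f') g')"

lemma unit_real_part_bound:
  assumes "unit_real_part C"
  obtains K where "0 \<le> K" "\<And>x. cmod (cinner (C x) x) \<le> K * (norm x)\<^sup>2"
proof -
  have "bounded_linear C"
    using assms by (simp add: unit_real_part_def bounded_clinear_def)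
  then obtain K where K: "0 \<le> K" "\<And>x. norm (C x) \<le> norm x * K"
    using bounded_linear.nonneg_bounded by blast
  have "cmod (cinner (C x) x) \<le> K * (norm x)\<^sup>2" for x
  proof -
    have "cmod (cinner (C x) x) \<le> norm (C x) * norm x"
      by (rule cmod_cinner_le)
    also have "\<dots> \<le> (norm x * K) * norm x"
      by (intro mult_right_mono K) simp
    finally show ?thesis
      by (simp add: power2_eq_square mult_ac)
  qed
  with K(1) show ?thesis
    using that by blast
qed

text \<open>The modulus dominates the real part. Together with the bound from boundedness of
  \<open>C\<close>, this makes the modulus equivalent to the squared norm.\<close>

lemma unit_real_part_lower: "unit_real_part C \<Longrightarrow> (norm x)\<^sup>2 \<le> cmod (cinner (C x) x)"
  using complex_Re_le_cmod[of "cinner (C x) x"] by (simp add: unit_real_part_def)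

section \<open>Convergence, closedness and closure of a factored form\<close>

lemma factored_form_diff:
  assumes "factored_form t P C" "(x, y) \<in> P" "(x', y') \<in> P"
  shows "fval t (x - x') (x - x') = cinner (C (y - y')) (y - y')"
  using assms lin_rel_diff[of P x y x' y'] by (simp add: factored_form_def)

text \<open>The form at \<open>x n - x m\<close> is comparable to the squared norm of
  \<open>y n - y m\<close>, so being Cauchy for the form means that the images are Cauchy, hence
  convergent. The limit \<open>z\<close> is not tied to \<open>u\<close> as long as \<open>P\<close>
  may fail to be closed.\<close>

lemma form_conv_factored_iff:
  fixes P :: "('a::complex_inner \<times> 'b::chilbert_space) set"
  assumes t: "factored_form t P C" and C: "unit_real_part C"
  shows "form_conv t x u \<longleftrightarrow>
    (\<exists>y z. (\<forall>n. (x n, y n) \<in> P) \<and> x \<longlonglongrightarrow> u \<and> y \<longlonglongrightarrow> z)"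
proof
  assume conv: "form_conv t x u"
  then have "\<forall>n. \<exists>y. (x n, y) \<in> P"
    using t by (auto simp: form_conv_def factored_form_def Domain_iff)
  then obtain y where y: "\<And>n. (x n, y n) \<in> P"
    by metis
  have "Cauchy y"
  proof (rule CauchyI)
    fix e :: real assume "0 < e"
    then obtain N where
      N: "\<forall>m\<ge>N. \<forall>n\<ge>N. cmod (fval t (x n - x m) (x n - x m)) < e\<^sup>2"
      using conv unfolding form_conv_def by (meson zero_less_power)
    have "norm (y n - y m) < e" if "m \<ge> N" "n \<ge> N" for m n
    proof (rule power2_less_imp_less)
      show "(norm (y n - y m))\<^sup>2 < e\<^sup>2"
        using N that factored_form_diff[OF t y y, of n m] unit_real_part_lower[OF C, of "y n - y m"]
        by (metis le_less_trans)
    qed (use \<open>0 < e\<close> in simp)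
    then show "\<exists>N. \<forall>m\<ge>N. \<forall>n\<ge>N. norm (y m - y n) < e"
      by blast
  qed
  then show "\<exists>y z. (\<forall>n. (x n, y n) \<in> P) \<and> x \<longlonglongrightarrow> u \<and> y \<longlonglongrightarrow> z"
    using conv y by (auto simp: form_conv_def Cauchy_convergent_iff convergent_def)
next
  assume "\<exists>y z. (\<forall>n. (x n, y n) \<in> P) \<and> x \<longlonglongrightarrow> u \<and> y \<longlonglongrightarrow> z"
  then obtain y z where y: "\<And>n. (x n, y n) \<in> P" and x: "x \<longlonglongrightarrow> u" and z: "y \<longlonglongrightarrow> z"
    by blast
  obtain K where K: "0 \<le> K" "\<And>v. cmod (cinner (C v) v) \<le> K * (norm v)\<^sup>2"
    using unit_real_part_bound[OF C] by blast
  have "\<exists>N. \<forall>m\<ge>N. \<forall>n\<ge>N. cmod (fval t (x n - x m) (x n - x m)) < e" if "0 < e" for e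
  proof -
    \<comment> \<open>Dividing by \<open>K + 1\<close> keeps the denominator positive when
      \<open>K\<close> is zero.\<close>
    have "0 < sqrt (e / (K + 1))"
      using that K(1) by simp
    moreover have "Cauchy y"
      using z by (rule LIMSEQ_imp_Cauchy)
    ultimately obtain N where
      N: "\<And>m n. m \<ge> N \<Longrightarrow> n \<ge> N \<Longrightarrow> norm (y m - y n) < sqrt (e / (K + 1))"
      using CauchyD by blast
    have "cmod (fval t (x n - x m) (x n - x m)) < e" if "m \<ge> N" "n \<ge> N" for m n
    proof -
      have "(norm (y n - y m))\<^sup>2 < (sqrt (e / (K + 1)))\<^sup>2"
        using N[OF that(2,1)] by (intro power_strict_mono) auto
      then have less: "(K + 1) * (norm (y n - y m))\<^sup>2 < e"
        using \<open>0 < e\<close> K(1) by (simp add: field_simps)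
      have "cmod (fval t (x n - x m) (x n - x m)) \<le> K * (norm (y n - y m))\<^sup>2"
        using factored_form_diff[OF t y y] K(2) by simp
      also have "\<dots> \<le> (K + 1) * (norm (y n - y m))\<^sup>2"
        by (intro mult_right_mono) auto
      also note less
      finally show ?thesis .
    qed
    then show ?thesis
      by blast
  qed
  moreover have "x n \<in> fdom t" for n
    using y t by (auto simp: factored_form_def)
  ultimately show "form_conv t x u"
    using x by (simp add: form_conv_def)
qed

text \<open>If graph points of \<open>P\<close> tend to \<open>(u, z)\<close>, their first entries
  converge to \<open>u\<close> for the form, so \<open>u\<close> lies in the domain. The lower bound
  on \<open>C\<close> then makes the images tend to the image of \<open>u\<close>, which must be
  \<open>z\<close>.\<close>

lemma closed_form_imp_closed_factor:
  fixes P :: "('a::complex_inner \<times> 'b::chilbert_space) set"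
  assumes t: "factored_form t P C" and C: "unit_real_part C" and "closed_form t"
  shows "closed P"
proof -
  have "(u, z) \<in> P" if p: "\<And>n. p n \<in> P" "p \<longlonglongrightarrow> (u, z)" for p u z
  proof -
    define x y where "x n = fst (p n)" and "y n = snd (p n)" for n
    have xy: "\<And>n. (x n, y n) \<in> P" and x: "x \<longlonglongrightarrow> u" and y: "y \<longlonglongrightarrow> z"
      using p tendsto_fst[OF p(2)] tendsto_snd[OF p(2)] by (simp_all add: x_def[abs_def] y_def[abs_def])
    then have "form_conv t x u"
      using form_conv_factored_iff[OF t C] by blast
    then have "u \<in> fdom t" and lim: "(\<lambda>n. fval t (x n - u) (x n - u)) \<longlonglongrightarrow> 0"
      using \<open>closed_form t\<close> by (auto simp: closed_form_def)
    then obtain w where w: "(u, w) \<in> P"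
      using t by (auto simp: factored_form_def)
    have "(\<lambda>n. (norm (y n - w))\<^sup>2) \<longlonglongrightarrow> 0"
    proof (rule Lim_null_comparison[OF _ tendsto_norm_zero[OF lim]])
      show "\<forall>\<^sub>F n in sequentially. norm ((norm (y n - w))\<^sup>2) \<le> cmod (fval t (x n - u) (x n - u))"
        using unit_real_part_lower[OF C] factored_form_diff[OF t xy w] by simp
    qed
    moreover have "(\<lambda>n. (norm (y n - w))\<^sup>2) \<longlonglongrightarrow> (norm (z - w))\<^sup>2"
      by (intro tendsto_intros y)
    ultimately have "(norm (z - w))\<^sup>2 = 0"
      using LIMSEQ_unique by blast
    then show ?thesis
      using w by simp
  qed
  then show ?thesis
    unfolding closed_sequential_limits by auto
qed

text \<open>The limit pair \<open>(u, z)\<close> stays in \<open>P\<close>, and continuity of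
  \<open>C\<close> sends the form values at \<open>x n - u\<close> to zero.\<close>

lemma closed_factor_imp_closed_form:
  fixes P :: "('a::complex_inner \<times> 'b::chilbert_space) set"
  assumes t: "factored_form t P C" and C: "unit_real_part C" and "closed P"
  shows "closed_form t"
  unfolding closed_form_def
proof (intro allI impI)
  fix x u assume "form_conv t x u"
  then obtain y z where xy: "\<And>n. (x n, y n) \<in> P" and lim: "x \<longlonglongrightarrow> u" "y \<longlonglongrightarrow> z"
    using form_conv_factored_iff[OF t C] by blast
  then have "(\<lambda>n. (x n, y n)) \<longlonglongrightarrow> (u, z)"
    by (intro tendsto_Pair)
  then have uz: "(u, z) \<in> P"
    by (rule closed_sequentially[OF \<open>closed P\<close> xy])
  have bl: "bounded_linear C"
    using C by (simp add: unit_real_part_def bounded_clinear_def)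
  have "(\<lambda>n. y n - z) \<longlonglongrightarrow> 0"
    using lim(2) by (simp add: LIM_zero)
  then have "(\<lambda>n. cinner (C (y n - z)) (y n - z)) \<longlonglongrightarrow> cinner (C 0) 0"
    by (intro tendsto_cinner bounded_linear.tendsto[OF bl])
  then have "(\<lambda>n. fval t (x n - u) (x n - u)) \<longlonglongrightarrow> 0"
    by (simp add: factored_form_diff[OF t xy uz])
  moreover have "u \<in> fdom t"
    using uz t by (auto simp: factored_form_def)
  ultimately show "u \<in> fdom t \<and> (\<lambda>n. fval t (x n - u) (x n - u)) \<longlonglongrightarrow> 0"
    by blast
qed

text \<open>Closing the form amounts to closing the factor. Single-valuedness of
  \<open>closure P\<close> makes the limit of the images depend on \<open>u\<close> alone, so that
  the values of \<open>form_closure\<close> are well defined.\<close>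

lemma factored_form_closure:
  fixes P :: "('a::complex_inner \<times> 'b::chilbert_space) set"
  assumes t: "factored_form t P C" and C: "unit_real_part C" and sv: "single_valued (closure P)"
  shows "factored_form (form_closure t) (closure P) C"
proof -
  have conv: "form_conv t x u \<longleftrightarrow> (\<exists>y z. (\<forall>n. (x n, y n) \<in> P) \<and> x \<longlonglongrightarrow> u \<and> y \<longlonglongrightarrow> z \<and> (u, z) \<in> closure P)"
    for x u
  proof -
    have "(u, z) \<in> closure P" if "\<forall>n. (x n, y n) \<in> P" "x \<longlonglongrightarrow> u" "y \<longlonglongrightarrow> z" for y z
      unfolding closure_sequential using that
      by (intro exI[of _ "\<lambda>n. (x n, y n)"]) (auto intro: tendsto_Pair)
    then show ?thesis
      unfolding form_conv_factored_iff[OF t C] by blast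
  qed
  have ex: "\<exists>x. form_conv t x u" if "(u, z) \<in> closure P" for u z
  proof -
    from that obtain p where p: "\<forall>n. p n \<in> P" "p \<longlonglongrightarrow> (u, z)"
      by (auto simp: closure_sequential)
    have "form_conv t (\<lambda>n. fst (p n)) u"
      unfolding form_conv_factored_iff[OF t C] using p tendsto_fst[OF p(2)] tendsto_snd[OF p(2)]
      by (intro exI[of _ "\<lambda>n. snd (p n)"] exI[of _ z]) simp
    then show ?thesis
      by (intro exI)
  qed
  have "bounded_linear C"
    using C by (simp add: unit_real_part_def bounded_clinear_def)
  have lim: "(\<lambda>n. fval t (x n) (y n)) \<longlonglongrightarrow> cinner (C u') v'"
    if c: "form_conv t x u" "form_conv t y v" and "(u, u') \<in> closure P" "(v, v') \<in> closure P" for x y u v u' v'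
  proof -
    obtain x' a where x': "\<forall>n. (x n, x' n) \<in> P" "x' \<longlonglongrightarrow> a" "(u, a) \<in> closure P"
      using c(1) unfolding conv by blast
    obtain y' b where y': "\<forall>n. (y n, y' n) \<in> P" "y' \<longlonglongrightarrow> b" "(v, b) \<in> closure P"
      using c(2) unfolding conv by blast
    have "a = u'" "b = v'"
      using single_valuedD[OF sv] x'(3) y'(3) that(3,4) by blast+
    then have "x' \<longlonglongrightarrow> u'" "y' \<longlonglongrightarrow> v'"
      using x'(2) y'(2) by simp_all
    then have "(\<lambda>n. cinner (C (x' n)) (y' n)) \<longlonglongrightarrow> cinner (C u') v'"
      by (intro tendsto_cinner bounded_linear.tendsto[OF \<open>bounded_linear C\<close>])
    moreover have "fval t (x n) (y n) = cinner (C (x' n)) (y' n)" for n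
      using t x' y' by (simp add: factored_form_def)
    ultimately show ?thesis
      by simp
  qed
  have "fval (form_closure t) u v = cinner (C u') v'"
    if uv: "(u, u') \<in> closure P" "(v, v') \<in> closure P" for u v u' v'
  proof -
    \<comment> \<open>The value is described by a condition on all approximating sequences; it
      singles out one number because such sequences exist.\<close>
    obtain x y where "form_conv t x u" "form_conv t y v"
      using ex[OF uv(1)] ex[OF uv(2)] by blast
    then show ?thesis
      unfolding form_closure_def form.sel using lim[OF _ _ uv] LIMSEQ_unique
      by (intro the_equality) blast+
  qed
  moreover have "fdom (form_closure t) = Domain (closure P)"
    unfolding form_closure_def form.sel using conv ex by (auto simp: Domain_iff)
  moreover have "lin_rel (closure P)"
    using t by (auto simp: factored_form_def intro: subspace_closure)
  ultimately show ?thesis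
    using sv by (simp add: factored_form_def)
qed

section \<open>Sectoriality of a factored form and its associated relation\<close>

lemma factored_form_sesquilinear:
  assumes t: "factored_form t P C" and C: "unit_real_part C"
  shows "sesquilinear_form t"
proof -
  have P: "lin_rel P" and dom: "fdom t = Domain P"
    and val: "\<And>f f' g g'. (f, f') \<in> P \<Longrightarrow> (g, g') \<in> P \<Longrightarrow> fval t f g = cinner (C f') g'"
    using t by (auto simp: factored_form_def)
  have lin: "C (c *\<^sub>C v) = c *\<^sub>C C v" "C (v + w) = C v + C w" for c v w
    using C by (auto simp: unit_real_part_def bounded_clinear_def linear_simps)
  have "(0, 0) \<in> P"
    using complex_vector.subspace_0[OF P] by (simp add: zero_prod_def)
  then have "complex_vector.subspace (fdom t)"
    unfolding dom by (intro complex_vector.subspaceI) (auto intro: lin_rel_add[OF P] lin_rel_scaleC[OF P])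
  moreover have "fval t (x + y) z = fval t x z + fval t y z \<and>
      fval t (c *\<^sub>C x) z = c * fval t x z \<and>
      fval t z (x + y) = fval t z x + fval t z y \<and>
      fval t z (c *\<^sub>C x) = cnj c * fval t z x"
    if xyz: "x \<in> fdom t" "y \<in> fdom t" "z \<in> fdom t" for x y z c
  proof -
    obtain x' y' z' where P': "(x, x') \<in> P" "(y, y') \<in> P" "(z, z') \<in> P"
      using xyz unfolding dom by blast
    then have "(x + y, x' + y') \<in> P" "(c *\<^sub>C x, c *\<^sub>C x') \<in> P"
      by (auto intro: lin_rel_add[OF P] lin_rel_scaleC[OF P])
    with P' show ?thesis
      by (simp add: val lin cinner_add_left cinner_add_right cinner_scaleC_left cinner_scaleC_right)
  qed
  ultimately show ?thesis
    by (auto simp: sesquilinear_form_def)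
qed

text \<open>The real part of the form is exactly the squared norm of the image, so the bound
  \<open>K\<close> for the modulus serves as the tangent of a semi-angle.\<close>

lemma factored_form_sectorial:
  assumes t: "factored_form t P C" and C: "unit_real_part C"
  shows "sectorial_form t"
proof -
  obtain K where K: "0 \<le> K" "\<And>x. cmod (cinner (C x) x) \<le> K * (norm x)\<^sup>2"
    using unit_real_part_bound[OF C] by blast
  have "\<bar>Im (fval t f f)\<bar> \<le> tan (arctan K) * Re (fval t f f)" if f: "f \<in> fdom t" for f
  proof -
    obtain f' where "(f, f') \<in> P"
      using t f unfolding factored_form_def by blast
    then have "fval t f f = cinner (C f') f'"
      using t by (simp add: factored_form_def)
    then show ?thesis
      using C K(2)[of f'] abs_Im_le_cmod[of "cinner (C f') f'"]
      by (simp add: unit_real_part_def tan_arctan)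
  qed
  moreover have "0 \<le> arctan K" "arctan K < pi / 2"
    using K(1) arctan_ubound by auto
  ultimately show ?thesis
    unfolding sectorial_form_def using factored_form_sesquilinear[OF assms] by blast
qed

text \<open>That (C P f, P g) = (h, g) for all \<open>g\<close> in the domain of \<open>P\<close> is
  precisely membership of \<open>(C f', h)\<close> in the adjoint of \<open>P\<close>, where
  \<open>f'\<close> is the image of \<open>f\<close>. If the domain of \<open>P\<close> is not
  dense, the multivalued part enters through \<open>adjoint_rel P\<close>.\<close>

lemma rel_of_factored_form:
  assumes "factored_form t P C"
  shows "rel_of_form t = P O graph_rel C O adjoint_rel P"
proof -
  have P: "single_valued P" and dom: "fdom t = Domain P"
    and val: "\<And>f f' g g'. (f, f') \<in> P \<Longrightarrow> (g, g') \<in> P \<Longrightarrow> fval t f g = cinner (C f') g'"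
    using assms by (auto simp: factored_form_def)
  have eq: "(\<forall>g\<in>Domain P. fval t f g = cinner h g) \<longleftrightarrow> (C f', h) \<in> adjoint_rel P"
    if "(f, f') \<in> P" for f f' h
    unfolding adjoint_rel_def using val[OF that] by (auto intro!: DomainI) (metis DomainI)
  have "(f, h) \<in> rel_of_form t \<longleftrightarrow> (\<exists>f'. (f, f') \<in> P \<and> (C f', h) \<in> adjoint_rel P)" for f h
    unfolding rel_of_form_def dom mem_Collect_eq case_prod_conv using eq by blast
  then show ?thesis
    by (auto simp: graph_rel_def relcomp_unfold)
qed

text \<open>Linearity of \<open>V\<close> comes for free: \<open>v = V (x + y) - V x - V y\<close> satisfies
  \<open>(C v, V k) = 0\<close> for all \<open>k\<close> in the domain, hence \<open>(C v, v) = 0\<close>.\<close>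

lemma factored_form_graph:
  assumes t: "sesquilinear_form t" and C: "unit_real_part C"
    and val: "\<And>h k. h \<in> fdom t \<Longrightarrow> k \<in> fdom t \<Longrightarrow> fval t h k = cinner (C (V h)) (V k)"
  shows "factored_form t {(h, V h) | h. h \<in> fdom t} C"
proof -
  have sub: "complex_vector.subspace (fdom t)"
    using t by (simp add: sesquilinear_form_def)
  have form: "fval t (x + y) z = fval t x z + fval t y z" "fval t (c *\<^sub>C x) z = c * fval t x z"
    if "x \<in> fdom t" "y \<in> fdom t" "z \<in> fdom t" for x y z c
    using t that by (auto simp: sesquilinear_form_def)
  have lin: "C (c *\<^sub>C v) = c *\<^sub>C C v" "C (v + w) = C v + C w" "C (v - w) = C v - C w" for c v w
    using C by (auto simp: unit_real_part_def bounded_clinear_def linear_simps)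
  have zero: "v = 0" if "cinner (C v) v = 0" for v
    using unit_real_part_lower[OF C, of v] that by simp
  have "V (x + y) = V x + V y" if xy: "x \<in> fdom t" "y \<in> fdom t" for x y
  proof -
    let ?v = "V (x + y) - (V x + V y)"
    have "x + y \<in> fdom t"
      using xy by (rule complex_vector.subspace_add[OF sub])
    then have orth: "cinner (C ?v) (V k) = 0" if "k \<in> fdom t" for k
      using xy that form(1)[of x y k] by (simp add: lin cinner_diff_left cinner_add_left val)
    have "?v = 0"
      by (rule zero)
        (simp only: cinner_diff_right cinner_add_right orth xy \<open>x + y \<in> fdom t\<close>, simp)
    then show ?thesis
      by simp
  qed
  moreover have "V (c *\<^sub>C x) = c *\<^sub>C V x" if x: "x \<in> fdom t" for x c
  proof -
    let ?v = "V (c *\<^sub>C x) - c *\<^sub>C V x"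
    have "c *\<^sub>C x \<in> fdom t"
      using x by (rule complex_vector.subspace_scale[OF sub])
    then have orth: "cinner (C ?v) (V k) = 0" if "k \<in> fdom t" for k
      using x that form(2)[of x x k c] by (simp add: lin cinner_diff_left cinner_scaleC_left val)
    have "?v = 0"
      by (rule zero)
        (simp only: cinner_diff_right cinner_scaleC_right orth x \<open>c *\<^sub>C x \<in> fdom t\<close>, simp)
    then show ?thesis
      by simp
  qed
  moreover have "0 \<in> fdom t"
    by (rule complex_vector.subspace_0[OF sub])
  moreover from this have "V 0 = 0"
    using calculation(2)[of 0 0] complex_vector.scale_zero_left by metis
  ultimately have "lin_rel {(h, V h) | h. h \<in> fdom t}"
    by (intro complex_vector.subspaceI)
      (auto simp: zero_prod_def scaleC_prod_def complex_vector.subspace_add[OF sub]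
        complex_vector.subspace_scale[OF sub])
  then show ?thesis
    using val by (auto simp: factored_form_def single_valued_def)
qed

section \<open>Operators of the form I + iB and their direct sums\<close>

lemma unit_real_part_one_plus_i:
  assumes B: "bounded_clinear B" and sa: "adjoint_rel (graph_rel B) = graph_rel B"
  shows "unit_real_part (one_plus_i B)"
proof -
  have bl: "bounded_linear B" and sc: "\<And>c x. B (c *\<^sub>C x) = c *\<^sub>C B x"
    using B by (auto simp: bounded_clinear_def)
  have "bounded_linear (one_plus_i B)"
    unfolding one_plus_i_def
    by (intro bounded_linear_add bounded_linear_ident
        bounded_linear_compose[OF bounded_linear_scaleC bl])
  moreover have "one_plus_i B (c *\<^sub>C x) = c *\<^sub>C one_plus_i B x" for c x
    by (simp add: one_plus_i_def sc scaleC_add_right scaleC_scaleC mult.commute)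
  moreover have "Re (cinner (one_plus_i B x) x) = (norm x)\<^sup>2" for x
  proof -
    \<comment> \<open>Selfadjointness makes (Bx, x) real, so the term with the factor i contributes
      only to the imaginary part.\<close>
    have "(x, B x) \<in> adjoint_rel (graph_rel B)"
      unfolding sa by (auto simp: graph_rel_def)
    then have "cinner x (B x) = cinner (B x) x"
      by (auto simp: adjoint_rel_def graph_rel_def)
    then have "Im (cinner (B x) x) = 0"
      by (metis cinner_commute Reals_cnj_iff complex_is_Real_iff)
    then show ?thesis
      by (simp add: one_plus_i_def cinner_add_left cinner_scaleC_left Re_cinner_self)
  qed
  ultimately show ?thesis
    by (simp add: unit_real_part_def bounded_clinear_def)
qed

lemma one_plus_i_map_prod:
  "one_plus_i (map_prod B\<^sub>1 B\<^sub>2) = map_prod (one_plus_i B\<^sub>1) (one_plus_i B\<^sub>2)"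
  by (auto simp: one_plus_i_def scaleC_prod_def)

lemma unit_real_part_map_prod:
  assumes "unit_real_part C\<^sub>1" "unit_real_part C\<^sub>2"
  shows "unit_real_part (map_prod C\<^sub>1 C\<^sub>2)"
proof -
  have "bounded_linear (\<lambda>p. (C\<^sub>1 (fst p), C\<^sub>2 (snd p)))"
    using assms
    by (intro bounded_linear_Pair bounded_linear_compose[OF _ bounded_linear_fst]
        bounded_linear_compose[OF _ bounded_linear_snd])
      (auto simp: unit_real_part_def bounded_clinear_def)
  moreover have "map_prod C\<^sub>1 C\<^sub>2 = (\<lambda>p. (C\<^sub>1 (fst p), C\<^sub>2 (snd p)))"
    by auto
  ultimately show ?thesis
    using assms
    by (auto simp: unit_real_part_def bounded_clinear_def scaleC_prod_def cinner_prod_def norm_prod_def)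
qed

section \<open>From the two given forms to the form of the sum\<close>

lemma represented_form_factored:
  fixes H A R :: "('a::chilbert_space \<times> 'a) set"
  assumes t: "closed_sectorial_form_of H t" and rep: "represents_form t A R B"
  defines "P \<equiv> {(h, op_apply R h) | h. h \<in> fdom t}"
  shows "unit_real_part (one_plus_i B)" and "factored_form t P (one_plus_i B)" and "closed P"
proof -
  show C: "unit_real_part (one_plus_i B)"
    using rep by (auto simp: represents_form_def intro: unit_real_part_one_plus_i)
  have "sesquilinear_form t" "closed_form t"
    using t by (auto simp: closed_sectorial_form_of_def sectorial_form_def)
  \<comment> \<open>The represented values of \<open>t\<close> force \<open>op_apply R\<close> to be
    linear on the form domain; closedness of its graph there then follows from closedness of
    \<open>t\<close>.\<close>
  then show F: "factored_form t P (one_plus_i B)"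
    unfolding P_def using rep C by (intro factored_form_graph) (auto simp: represents_form_def)
  show "closed P"
    by (rule closed_form_imp_closed_factor[OF F C \<open>closed_form t\<close>])
qed

text \<open>Pairing any image of \<open>f\<close> under the sum with \<open>g\<close> turns each
  summand into a value of its form, since \<open>g\<close> lies in both form domains. The result is
  the same for all images, so the definite description is justified.\<close>

lemma form_of_sum_rel:
  assumes "closed_sectorial_form_of H\<^sub>1 t\<^sub>1" "closed_sectorial_form_of H\<^sub>2 t\<^sub>2"
    and f: "f \<in> Domain H\<^sub>1 \<inter> Domain H\<^sub>2" and g: "g \<in> Domain H\<^sub>1 \<inter> Domain H\<^sub>2"
  shows "fval (form_of_rel (sum_rel H\<^sub>1 H\<^sub>2)) f g = fval t\<^sub>1 f g + fval t\<^sub>2 f g"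
proof -
  have H: "H\<^sub>1 = rel_of_form t\<^sub>1" "H\<^sub>2 = rel_of_form t\<^sub>2"
    using assms by (auto simp: closed_sectorial_form_of_def)
  have "g \<in> fdom t\<^sub>1" "g \<in> fdom t\<^sub>2"
    using g by (auto simp: H rel_of_form_def)
  then have val: "cinner h g = fval t\<^sub>1 f g + fval t\<^sub>2 f g" if "(f, h) \<in> sum_rel H\<^sub>1 H\<^sub>2" for h
    using that by (auto simp: sum_rel_def H rel_of_form_def cinner_add_left)
  obtain h where "(f, h) \<in> sum_rel H\<^sub>1 H\<^sub>2"
    using f by (auto simp: sum_rel_def)
  then show ?thesis
    unfolding form_of_rel_def form.sel using val by (intro the_equality) metis+
qed

lemma subspace_Domain:
  assumes "lin_rel T"
  shows "complex_vector.subspace (Domain T)"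
proof (rule complex_vector.subspaceI)
  show "0 \<in> Domain T"
    using complex_vector.subspace_0[OF assms] by (auto simp: zero_prod_def)
qed (auto intro: lin_rel_add[OF assms] lin_rel_scaleC[OF assms])

text \<open>The values add up over the two components of the product. The closure of
  \<open>\<Psi>\<close> is an operator because it is contained in a closed operator.\<close>

lemma factored_form_sum_rel:
  fixes H\<^sub>1 H\<^sub>2 A\<^sub>1 A\<^sub>2 R\<^sub>1 R\<^sub>2 :: "('a::chilbert_space \<times> 'a) set"
  assumes lin: "lin_rel H\<^sub>1" "lin_rel H\<^sub>2"
    and t: "closed_sectorial_form_of H\<^sub>1 t\<^sub>1" "closed_sectorial_form_of H\<^sub>2 t\<^sub>2"
    and rep: "represents_form t\<^sub>1 A\<^sub>1 R\<^sub>1 B\<^sub>1" "represents_form t\<^sub>2 A\<^sub>2 R\<^sub>2 B\<^sub>2"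
  defines "\<Psi> \<equiv> pair_op H\<^sub>1 H\<^sub>2 R\<^sub>1 R\<^sub>2"
  shows "factored_form (form_of_rel (sum_rel H\<^sub>1 H\<^sub>2)) \<Psi> (one_plus_i (map_prod B\<^sub>1 B\<^sub>2))"
    and "single_valued (closure \<Psi>)"
proof -
  define P\<^sub>1 where "P\<^sub>1 = {(h, op_apply R\<^sub>1 h) | h. h \<in> fdom t\<^sub>1}"
  define P\<^sub>2 where "P\<^sub>2 = {(h, op_apply R\<^sub>2 h) | h. h \<in> fdom t\<^sub>2}"
  have P: "closed P\<^sub>1" "closed P\<^sub>2"
    and F: "factored_form t\<^sub>1 P\<^sub>1 (one_plus_i B\<^sub>1)" "factored_form t\<^sub>2 P\<^sub>2 (one_plus_i B\<^sub>2)"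
    unfolding P\<^sub>1_def P\<^sub>2_def
    using represented_form_factored[OF t(1) rep(1)] represented_form_factored[OF t(2) rep(2)] by auto
  have dom: "Domain H\<^sub>1 \<subseteq> fdom t\<^sub>1" "Domain H\<^sub>2 \<subseteq> fdom t\<^sub>2"
    using t by (auto simp: closed_sectorial_form_of_def rel_of_form_def)
  define D where "D = Domain H\<^sub>1 \<inter> Domain H\<^sub>2"
  \<comment> \<open>The same pair of maps on the whole intersection of the form domains, which
    contains \<open>D\<close>. As \<open>P\<^sub>1\<close> and \<open>P\<^sub>2\<close> are closed,
    so is \<open>Q\<close>, and it therefore contains the closure of \<open>\<Psi>\<close>.\<close>
  define Q where "Q = {(h, (a, b)) | h a b. (h, a) \<in> P\<^sub>1 \<and> (h, b) \<in> P\<^sub>2}"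
  have "Q = (\<lambda>p. (fst p, fst (snd p))) -` P\<^sub>1 \<inter> (\<lambda>p. (fst p, snd (snd p))) -` P\<^sub>2"
    by (auto simp: Q_def)
  then have "closed Q"
    using P by (auto intro!: closed_Int continuous_closed_vimage continuous_intros)
  have \<Psi>Q: "\<Psi> = {p \<in> Q. fst p \<in> D}"
    using dom by (auto simp: \<Psi>_def Q_def P\<^sub>1_def P\<^sub>2_def pair_op_def D_def)
  then have "closure \<Psi> \<subseteq> Q"
    using \<open>closed Q\<close> by (intro closure_minimal) auto
  moreover have Q_sv: "single_valued Q"
    by (auto simp: Q_def P\<^sub>1_def P\<^sub>2_def single_valued_def)
  ultimately show "single_valued (closure \<Psi>)"
    by (meson single_valued_subset)
  have lP: "lin_rel P\<^sub>1" "lin_rel P\<^sub>2"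
    using F by (auto simp: factored_form_def)
  have sD: "complex_vector.subspace D"
    unfolding D_def by (intro complex_vector.subspace_inter subspace_Domain lin)
  have "lin_rel \<Psi>"
  proof (rule complex_vector.subspaceI)
    show "0 \<in> \<Psi>"
      using complex_vector.subspace_0[OF lP(1)] complex_vector.subspace_0[OF lP(2)]
        complex_vector.subspace_0[OF sD]
      by (auto simp: \<Psi>Q Q_def zero_prod_def)
  next
    fix p q assume "p \<in> \<Psi>" "q \<in> \<Psi>"
    then show "p + q \<in> \<Psi>"
      by (auto simp: \<Psi>Q Q_def intro: lin_rel_add[OF lP(1)] lin_rel_add[OF lP(2)]
          complex_vector.subspace_add[OF sD])
  next
    fix c p assume "p \<in> \<Psi>"
    then show "c *\<^sub>C p \<in> \<Psi>"
      by (auto simp: \<Psi>Q Q_def scaleC_prod_def intro: lin_rel_scaleC[OF lP(1)]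
          lin_rel_scaleC[OF lP(2)] complex_vector.subspace_scale[OF sD])
  qed
  moreover have "single_valued \<Psi>"
    using Q_sv by (rule single_valued_subset[rotated]) (auto simp: \<Psi>Q)
  moreover have "fdom (form_of_rel (sum_rel H\<^sub>1 H\<^sub>2)) = Domain \<Psi>"
    by (auto simp: form_of_rel_def sum_rel_def \<Psi>_def pair_op_def)
  moreover have "fval (form_of_rel (sum_rel H\<^sub>1 H\<^sub>2)) f g = cinner (one_plus_i (map_prod B\<^sub>1 B\<^sub>2) f') g'"
    if "(f, f') \<in> \<Psi>" "(g, g') \<in> \<Psi>" for f f' g g'
  proof -
    have "f \<in> D" "g \<in> D" "(f, fst f') \<in> P\<^sub>1" "(f, snd f') \<in> P\<^sub>2" "(g, fst g') \<in> P\<^sub>1" "(g, snd g') \<in> P\<^sub>2"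
      using that by (auto simp: \<Psi>Q Q_def)
    then show ?thesis
      using F form_of_sum_rel[OF t, of f g]
      by (simp add: factored_form_def D_def one_plus_i_map_prod cinner_prod_def)
  qed
  ultimately show "factored_form (form_of_rel (sum_rel H\<^sub>1 H\<^sub>2)) \<Psi> (one_plus_i (map_prod B\<^sub>1 B\<^sub>2))"
    by (simp add: factored_form_def)
qed

section \<open>The Friedrichs extension of the sum and its form\<close>

theorem theorem3p2:
  fixes H\<^sub>1 H\<^sub>2 A\<^sub>1 A\<^sub>2 R\<^sub>1 R\<^sub>2 :: "('a::chilbert_space \<times> 'a) set"
    and t\<^sub>1 t\<^sub>2 :: "'a form"
    and B\<^sub>1 B\<^sub>2 :: "'a \<Rightarrow> 'a"
    and B :: "'a \<times> 'a \<Rightarrow> 'a \<times> 'a"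
    and \<Psi> :: "('a \<times> ('a \<times> 'a)) set"
  assumes "maximal_sectorial H\<^sub>1" and "maximal_sectorial H\<^sub>2"
    and "closed_sectorial_form_of H\<^sub>1 t\<^sub>1" and "closed_sectorial_form_of H\<^sub>2 t\<^sub>2"
    and "A\<^sub>1 = rel_of_form (re_form t\<^sub>1)" and "A\<^sub>2 = rel_of_form (re_form t\<^sub>2)"
    and "nonneg_sqrt_in (ocompl (mul_rel A\<^sub>1)) (op_part A\<^sub>1) R\<^sub>1"
    and "nonneg_sqrt_in (ocompl (mul_rel A\<^sub>2)) (op_part A\<^sub>2) R\<^sub>2"
    and "represents_form t\<^sub>1 A\<^sub>1 R\<^sub>1 B\<^sub>1" and "represents_form t\<^sub>2 A\<^sub>2 R\<^sub>2 B\<^sub>2"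
    and "B = map_prod B\<^sub>1 B\<^sub>2"
    and "\<Psi> = pair_op H\<^sub>1 H\<^sub>2 R\<^sub>1 R\<^sub>2"
  shows "friedrichs_ext (sum_rel H\<^sub>1 H\<^sub>2) =
           adjoint_rel (adjoint_rel \<Psi>) O graph_rel (one_plus_i B) O adjoint_rel \<Psi> \<and>
         closed_sectorial_form_of (friedrichs_ext (sum_rel H\<^sub>1 H\<^sub>2))
           (friedrichs_form (sum_rel H\<^sub>1 H\<^sub>2)) \<and>
         fdom (friedrichs_form (sum_rel H\<^sub>1 H\<^sub>2)) = Domain (adjoint_rel (adjoint_rel \<Psi>)) \<and>
         (\<forall>f\<in>fdom (friedrichs_form (sum_rel H\<^sub>1 H\<^sub>2)). \<forall>g\<in>fdom (friedrichs_form (sum_rel H\<^sub>1 H\<^sub>2)).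
            fval (friedrichs_form (sum_rel H\<^sub>1 H\<^sub>2)) f g =
              cinner (one_plus_i B (op_apply (adjoint_rel (adjoint_rel \<Psi>)) f))
                (op_apply (adjoint_rel (adjoint_rel \<Psi>)) g))"
proof -
  define C where "C = one_plus_i B"
  define tF where "tF = friedrichs_form (sum_rel H\<^sub>1 H\<^sub>2)"
  have lin: "lin_rel H\<^sub>1" "lin_rel H\<^sub>2"
    using assms(1,2) by (auto simp: maximal_sectorial_def sectorial_rel_def)
  have S: "factored_form (form_of_rel (sum_rel H\<^sub>1 H\<^sub>2)) \<Psi> C" and sv: "single_valued (closure \<Psi>)"
    using factored_form_sum_rel[OF lin assms(3,4,9,10)] by (simp_all add: C_def assms(11,12))
  have C: "unit_real_part C"
    unfolding C_def assms(11) one_plus_i_map_prod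
    by (intro unit_real_part_map_prod represented_form_factored(1)[OF assms(3,9)]
        represented_form_factored(1)[OF assms(4,10)])
  have adj: "adjoint_rel (adjoint_rel \<Psi>) = closure \<Psi>"
    using S by (intro adjoint_adjoint_eq_closure) (simp add: factored_form_def)
  have F: "factored_form tF (closure \<Psi>) C"
    unfolding tF_def friedrichs_form_def by (rule factored_form_closure[OF S C sv])
  \<comment> \<open>The outer factor is the adjoint of \<open>closure \<Psi>\<close>, which
    coincides with the adjoint of \<open>\<Psi>\<close> itself.\<close>
  have "rel_of_form tF = closure \<Psi> O graph_rel C O adjoint_rel \<Psi>"
    using rel_of_factored_form[OF F] by (simp add: adjoint_rel_closure)
  \<comment> \<open>The Friedrichs extension is by definition the relation of \<open>tF\<close>, so
    the correspondence reduces to \<open>tF\<close> being sectorial, by the bounds on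
    \<open>C\<close>, and closed, because its factor is.\<close>
  moreover have "closed_sectorial_form_of (rel_of_form tF) tF"
    unfolding closed_sectorial_form_of_def
    using factored_form_sectorial[OF F C] closed_factor_imp_closed_form[OF F C] by simp
  moreover have "fdom tF = Domain (closure \<Psi>)"
    using F by (simp add: factored_form_def)
  moreover have "fval tF f g = cinner (C (op_apply (closure \<Psi>) f)) (op_apply (closure \<Psi>) g)"
    if "f \<in> fdom tF" "g \<in> fdom tF" for f g
    using F that op_apply_eq[OF sv] by (fastforce simp: factored_form_def)
  ultimately show ?thesis
    unfolding friedrichs_ext_def tF_def[symmetric] C_def[symmetric] adj by blast
qed

end
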